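(* Let $X$ be a topological space and let $g,h,k\in H_2(X)$ be invertible continuous binary operations of $X$. If $(g,h)$ and $(g,k)$ are distributive pairs, then $(g,hk)$ is also a distributive pair.
   Context: For a topological space $X$, $C_2(X)$ denotes the set of all continuous binary operations $f:X^2\to X$. It is a monoid under the operation $(f\varphi)(x,y)=f(x,\varphi(x,y))$, with identity element $e(x,y)=y$. $H_2(X)$ denotes the group of all invertible elements of the monoid $C_2(X)$; the product $hk$ is taken in this group. An ordered pair $(g,h)$ of elements of $H_2(X)$ is called a distributive pair if $g(x,h(y,z))=h(g(x,y),g(x,z))$ for all $x,y,z\in X$. *)

theory Defs
  imports "HOL-Analysis.Product_Topology" "HOL-Algebra.Group"
begin

text \<open>
  Binary operations on a space \<open>X\<close> are functions on pairs. As only their values on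
  \<open>topspace X \<times> topspace X\<close> matter, they are taken \<open>extensional\<close> there
  (\<open>undefined\<close> elsewhere), so that equality in the monoid is equality as maps
  \<open>X\<^sup>2 \<rightarrow> X\<close>.
\<close>

definition C2 :: "'a topology \<Rightarrow> ('a \<times> 'a \<Rightarrow> 'a) monoid" where
  "C2 X =
    \<lparr>carrier = {f \<in> extensional (topspace X \<times> topspace X).
                 continuous_map (prod_topology X X) X f},
     mult = (\<lambda>f \<phi>. \<lambda>(x, y) \<in> topspace X \<times> topspace X. f (x, \<phi> (x, y))),
     one = (\<lambda>(x, y) \<in> topspace X \<times> topspace X. y)\<rparr>"

definition H2 :: "'a topology \<Rightarrow> ('a \<times> 'a \<Rightarrow> 'a) monoid" where
  "H2 X = units_of (C2 X)"

definition distributive_pair :: "'a topology \<Rightarrow> ('a \<times> 'a \<Rightarrow> 'a) \<Rightarrow> ('a \<times> 'a \<Rightarrow> 'a) \<Rightarrow> bool" where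
  "distributive_pair X g h \<longleftrightarrow>
     g \<in> carrier (H2 X) \<and> h \<in> carrier (H2 X) \<and>
     (\<forall>x \<in> topspace X. \<forall>y \<in> topspace X. \<forall>z \<in> topspace X.
        g (x, h (y, z)) = h (g (x, y), g (x, z)))"

lemma C2_closed:
  assumes "f \<in> carrier (C2 X)" "x \<in> topspace X" "y \<in> topspace X"
  shows "f (x, y) \<in> topspace X"
  using assms continuous_map_image_subset_topspace[of "prod_topology X X" X f]
  by (auto simp: C2_def)

lemma monoid_C2: "monoid (C2 X)"
proof (rule monoidI)
  fix f g assume f: "f \<in> carrier (C2 X)" and g: "g \<in> carrier (C2 X)"
  have "continuous_map (prod_topology X X) X (f \<circ> (\<lambda>p. (fst p, g p)))"
    using f g by (intro continuous_map_compose[of _ "prod_topology X X"])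
      (auto simp: C2_def continuous_map_pairwise o_def continuous_map_fst)
  then have "continuous_map (prod_topology X X) X (f \<otimes>\<^bsub>C2 X\<^esub> g)"
    by (rule continuous_map_eq) (auto simp: C2_def)
  then show "f \<otimes>\<^bsub>C2 X\<^esub> g \<in> carrier (C2 X)"
    by (simp add: C2_def)
next
  have "continuous_map (prod_topology X X) X \<one>\<^bsub>C2 X\<^esub>"
    by (rule continuous_map_eq[OF continuous_map_snd]) (auto simp: C2_def)
  then show "\<one>\<^bsub>C2 X\<^esub> \<in> carrier (C2 X)"
    by (simp add: C2_def)
next
  fix f g h assume "f \<in> carrier (C2 X)" "g \<in> carrier (C2 X)" and h: "h \<in> carrier (C2 X)"
  then show "f \<otimes>\<^bsub>C2 X\<^esub> g \<otimes>\<^bsub>C2 X\<^esub> h = f \<otimes>\<^bsub>C2 X\<^esub> (g \<otimes>\<^bsub>C2 X\<^esub> h)"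
    using C2_closed[OF h] by (auto simp: C2_def fun_eq_iff)
next
  fix f assume f: "f \<in> carrier (C2 X)"
  show "\<one>\<^bsub>C2 X\<^esub> \<otimes>\<^bsub>C2 X\<^esub> f = f" "f \<otimes>\<^bsub>C2 X\<^esub> \<one>\<^bsub>C2 X\<^esub> = f"
    using f C2_closed[OF f] by (auto simp: C2_def fun_eq_iff extensional_def)
qed

lemma group_H2: "group (H2 X)"
  unfolding H2_def by (rule monoid.units_group[OF monoid_C2])

end

theory Submission
  imports Defs
begin

text \<open>
  Write \<open>g\<^sub>x\<close> for the map \<open>z \<mapsto> g (x, z)\<close>. Distributivity says that each \<open>g\<^sub>x\<close> is an
  endomorphism of the second operation. The product \<open>hk\<close> is the composite term
  \<open>h (y, k (y, z))\<close> in \<open>h\<close> and \<open>k\<close>, and a map that preserves two operations preserves every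
  operation composed from them: \<open>g\<^sub>x\<close> is moved first past \<open>h\<close> and then past \<open>k\<close>.
\<close>

lemma H2_closed:
  assumes "f \<in> carrier (H2 X)" "x \<in> topspace X" "y \<in> topspace X"
  shows "f (x, y) \<in> topspace X"
  using assms by (auto simp: H2_def units_of_def Units_def intro: C2_closed)

lemma H2_mult_apply:
  assumes "x \<in> topspace X" "y \<in> topspace X"
  shows "(h \<otimes>\<^bsub>H2 X\<^esub> k) (x, y) = h (x, k (x, y))"
  using assms by (simp add: H2_def units_of_def C2_def)

theorem proposition3p3:
  fixes X :: "'a topology" and g h k :: "'a \<times> 'a \<Rightarrow> 'a"
  assumes "g \<in> carrier (H2 X)" and "h \<in> carrier (H2 X)" and "k \<in> carrier (H2 X)"
    and "distributive_pair X g h" and "distributive_pair X g k"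
  shows "distributive_pair X g (h \<otimes>\<^bsub>H2 X\<^esub> k)"
  unfolding distributive_pair_def
proof (intro conjI ballI)
  show "g \<in> carrier (H2 X)" by fact
  show "h \<otimes>\<^bsub>H2 X\<^esub> k \<in> carrier (H2 X)"
    using group_H2 assms(2,3) by (metis group.is_monoid monoid.m_closed)
next
  fix x y z assume x: "x \<in> topspace X" and y: "y \<in> topspace X" and z: "z \<in> topspace X"
  have kyz: "k (y, z) \<in> topspace X"
    using assms(3) y z by (rule H2_closed)
  have gxy: "g (x, y) \<in> topspace X" and gxz: "g (x, z) \<in> topspace X"
    using assms(1) x y z by (auto intro: H2_closed)
  have "g (x, (h \<otimes>\<^bsub>H2 X\<^esub> k) (y, z)) = g (x, h (y, k (y, z)))"
    using y z by (simp add: H2_mult_apply)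
  also have "\<dots> = h (g (x, y), g (x, k (y, z)))"
    using assms(4) x y kyz by (simp add: distributive_pair_def)
  also have "\<dots> = h (g (x, y), k (g (x, y), g (x, z)))"
    using assms(5) x y z by (simp add: distributive_pair_def)
  also have "\<dots> = (h \<otimes>\<^bsub>H2 X\<^esub> k) (g (x, y), g (x, z))"
    using gxy gxz by (simp add: H2_mult_apply)
  finally show "g (x, (h \<otimes>\<^bsub>H2 X\<^esub> k) (y, z)) = (h \<otimes>\<^bsub>H2 X\<^esub> k) (g (x, y), g (x, z))" .
qed

end
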